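(* Let $H$ be a connected graph with radius $r(H)$. There are functions $f,g:\mathbb{N}\to\mathbb{N}$ with $f(n)/n\to\frac1{12}$ and $g(n)/(n\,r(H))\to 2$ as $n\to\infty$ such that for every sufficiently large $n$, the Cartesian power $H^{n}$ contains $f(n)$ pairwise completely independent spanning trees, each of diameter at most $g(n)$. (In short: there exist $(\frac1{12}+o(1))n$ completely independent spanning trees in $H^n$, each with diameter $(2+o(1))n\cdot r(H)$.)
   Context: The Cartesian power $H^n$ has vertex set $V(H)^n$, where $\mathbf{u}=(u_1,\dots,u_n)$ and $\mathbf{u}'$ are adjacent iff there is $i\in[n]$ with $u_iu'_i\in E(H)$ and $u_j=u'_j$ for all $j\ne i$. The radius of a graph $G$ is $r(G)=\min_{u}\max_{v} d_G(u,v)$. Two spanning trees of a graph $G$ are completely independent if they have no edge in common and, for every pair of vertices $u,v$, the $u$–$v$ paths in the two trees have no vertex in common other than $u$ and $v$; a set of spanning trees is completely independent if its members are pairwise so. The diameter of a tree is the maximum distance within the tree between two of its vertices. *)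

theory Defs
  imports "Graph_Theory.Graph_Theory"
begin

text \<open>
  A finite simple undirected graph is a \<^locale>\<open>pair_graph\<close>: a finite, loopfree, symmetric
  digraph, in which the two arcs \<open>(u, v)\<close> and \<open>(v, u)\<close> together represent one edge.
\<close>

text \<open>The distance is unspecified if there is no walk from \<open>u\<close> to \<open>v\<close>.\<close>

definition graph_dist :: "('a, 'b) pre_digraph \<Rightarrow> 'a \<Rightarrow> 'a \<Rightarrow> nat" where
  "graph_dist G u v = (LEAST k. \<exists>p. pre_digraph.awalk G u p v \<and> length p = k)"

definition graph_radius :: "('a, 'b) pre_digraph \<Rightarrow> nat" where
  "graph_radius G = (MIN u\<in>verts G. MAX v\<in>verts G. graph_dist G u v)"

definition graph_diameter :: "('a, 'b) pre_digraph \<Rightarrow> nat" where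
  "graph_diameter G = (MAX (u, v)\<in>verts G \<times> verts G. graph_dist G u v)"

definition cartesian_power :: "'a pair_pre_digraph \<Rightarrow> nat \<Rightarrow> 'a list pair_pre_digraph" where
  "cartesian_power H n =
    (let V = {us. length us = n \<and> set us \<subseteq> pverts H} in
     \<lparr> pverts = V,
       parcs = {(us, vs). us \<in> V \<and> vs \<in> V \<and>
         (\<exists>i<n. (us ! i, vs ! i) \<in> parcs H \<and> (\<forall>j<n. j \<noteq> i \<longrightarrow> us ! j = vs ! j))} \<rparr>)"

text \<open>
  The library's \<^const>\<open>tree\<close> and \<^const>\<open>spanning_tree\<close> are not usable for undirected graphs:
  in a symmetric digraph \<^const>\<open>pre_digraph.cycle\<close> also holds of the closed walk
  \<open>u, v, u\<close> along a single edge. The cycles of the undirected graph are those of length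
  at least 3.
\<close>

definition undirected_tree :: "'a pair_pre_digraph \<Rightarrow> bool" where
  "undirected_tree T \<longleftrightarrow>
     pair_graph T \<and> Digraph_Component.connected (with_proj T) \<and>
     (\<nexists>c. pre_digraph.cycle (with_proj T) c \<and> 3 \<le> length c)"

definition undirected_spanning_tree :: "'a pair_pre_digraph \<Rightarrow> 'a pair_pre_digraph \<Rightarrow> bool" where
  "undirected_spanning_tree T G \<longleftrightarrow>
     undirected_tree T \<and> spanning (with_proj T) (with_proj G)"

definition completely_independent :: "'a pair_pre_digraph \<Rightarrow> 'a pair_pre_digraph \<Rightarrow> bool" where
  "completely_independent S T \<longleftrightarrow>
     parcs S \<inter> parcs T = {} \<and>
     (\<forall>u v p q. pre_digraph.apath (with_proj S) u p v \<longrightarrow>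
                pre_digraph.apath (with_proj T) u q v \<longrightarrow>
                set (pawalk_verts u p) \<inter> set (pawalk_verts u q) \<subseteq> {u, v})"

lemma (in wf_digraph) graph_dist_eq_\<mu>:
  assumes "u \<rightarrow>\<^sup>*\<^bsub>G\<^esub> v"
  shows "\<mu> (\<lambda>_. 1) u v = ereal (real (graph_dist G u v))"
proof -
  from assms obtain p0 where "awalk u p0 v"
    by (auto simp: reachable_awalk)
  then have "\<exists>k p. awalk u p v \<and> length p = k" by blast
  from LeastI_ex[OF this] obtain p where p: "awalk u p v" "length p = graph_dist G u v"
    unfolding graph_dist_def by blast
  have le: "graph_dist G u v \<le> length q" if "awalk u q v" for q
    unfolding graph_dist_def using that by (intro Least_le) blast
  have cost: "awalk_cost (\<lambda>_. 1) q = real (length q)" for q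
    by (induction q) auto
  show ?thesis
    unfolding \<mu>_def
  proof (rule antisym)
    show "(INF q\<in>{q. awalk u q v}. ereal (awalk_cost (\<lambda>_. 1) q)) \<le> ereal (real (graph_dist G u v))"
      using p by (intro INF_lower2[of p]) (simp_all add: cost)
    show "ereal (real (graph_dist G u v)) \<le> (INF q\<in>{q. awalk u q v}. ereal (awalk_cost (\<lambda>_. 1) q))"
      by (rule INF_greatest) (simp add: cost le)
  qed
qed

lemma pair_graph_cartesian_power:
  assumes "pair_graph H"
  shows "pair_graph (cartesian_power H n)"
proof -
  interpret H: pair_graph H by fact
  define V where "V = {us. length us = n \<and> set us \<subseteq> pverts H}"
  define A where "A = {(us, vs). us \<in> V \<and> vs \<in> V \<and>
    (\<exists>i<n. (us ! i, vs ! i) \<in> parcs H \<and> (\<forall>j<n. j \<noteq> i \<longrightarrow> us ! j = vs ! j))}"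
  have power: "cartesian_power H n = \<lparr> pverts = V, parcs = A \<rparr>"
    by (simp add: cartesian_power_def V_def A_def Let_def)
  have fin: "finite V"
    unfolding V_def using finite_lists_length_eq[OF H.pair_finite_verts, of n]
    by (simp add: conj_commute)
  have "A \<subseteq> V \<times> V" by (auto simp: A_def)
  moreover from this fin have "finite A" by (meson finite_SigmaI finite_subset)
  moreover have "(vs, us) \<in> A" if "(us, vs) \<in> A" for us vs
  proof -
    from that obtain i where "i < n" "(us ! i, vs ! i) \<in> parcs H" "us \<in> V" "vs \<in> V"
      "\<forall>j<n. j \<noteq> i \<longrightarrow> us ! j = vs ! j"
      by (auto simp: A_def)
    then have "(vs ! i, us ! i) \<in> parcs H" "\<forall>j<n. j \<noteq> i \<longrightarrow> vs ! j = us ! j"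
      by (auto intro: H.arcs_symmetric)
    with \<open>i < n\<close> \<open>us \<in> V\<close> \<open>vs \<in> V\<close> show ?thesis by (auto simp: A_def)
  qed
  moreover have "us \<noteq> vs" if "(us, vs) \<in> A" for us vs
  proof
    assume "us = vs"
    with that obtain i where "(us ! i, us ! i) \<in> parcs H" by (auto simp: A_def)
    then show False by (auto dest: H.no_loops')
  qed
  ultimately show ?thesis
    unfolding power using fin by unfold_locales (auto simp: symmetric_def sym_def)
qed

end

theory Submission
  imports Defs
begin

text \<open>
  Fix a centre \<open>c\<close> of \<open>H\<close> and a breadth-first search from it. For every vertex of \<open>H\<close> choose a
  neighbour of the other depth parity, its parent unless it is \<open>c\<close>; replacing one coordinate
  of a vertex of the power by this neighbour flips one bit of its vector of depth parities. These bit
  vectors are coloured with \<open>M = 2^m\<close> colours, where \<open>n/12 \<le> M < n/6\<close>, such that every colour class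
  is connected by short paths and supplies the inner vertices of one tree, while all other vertices
  are leaves attached to it.

  Most coordinates carry labels covering \<open>{0..<4 M}\<close>, and the XOR \<open>s\<close> of the labels at odd depth, a
  Hamming syndrome, can be changed to any value by one flip. The basic colour is \<open>s div 4\<close>, so each
  class contains one syndrome of every type \<open>s mod 4\<close>. A class need not be connected, so
  few further coordinates encode a flag \<open>w\<close>, two types \<open>p, q\<close> and a colour \<open>k\<close>: where \<open>w = 0\<close>, the
  vertices of type \<open>p\<close> or \<open>q\<close> get colour \<open>k\<close> instead. Inside such a layer the class of \<open>k\<close> can move all
  coordinates whose label has type \<open>0\<close> or \<open>p XOR q\<close>, and either of \<open>p, q\<close> that is not the current type can be
  changed freely. So four layers suffice to bring all coordinates to \<open>c\<close>, with a constant number of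
  additional steps. Two types remain untouched in every layer; hence every vertex
  sees two syndromes of each class, which leaves room to attach the leaves of all trees along
  distinct edges.
\<close>

section \<open>Spanning trees given by parent functions\<close>

lemma nth_pcas:
  assumes "pcas u p v" "k < length p"
  shows "p ! k = (pawalk_verts u p ! k, pawalk_verts u p ! Suc k)"
  using assms
proof (induction p arbitrary: u k)
  case (Cons e es)
  show ?case
  proof (cases k)
    case 0
    with Cons.prems show ?thesis by (cases es) auto
  next
    case (Suc k')
    with Cons.prems Cons.IH[of "snd e" k'] show ?thesis by simp
  qed
qed simp

lemma (in pair_sym_digraph) mk_symmetric_eq: "mk_symmetric (with_proj G) = G"
  using arcs_symmetric by (auto simp: mk_symmetric_def intro!: pair_pre_digraph.equality)

definition parent_tree :: "'v set \<Rightarrow> 'v \<Rightarrow> ('v \<Rightarrow> 'v) \<Rightarrow> 'v pair_pre_digraph" where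
  "parent_tree V \<rho> \<pi> =
     \<lparr> pverts = V, parcs = {(v, w). v \<in> V - {\<rho>} \<and> w = \<pi> v \<or> w \<in> V - {\<rho>} \<and> v = \<pi> w} \<rparr>"

text \<open>The rank \<open>d\<close> only has to drop strictly along parents and may exceed the
  depth in the tree. The drop excludes cycles and bounds the distance to the root by
  \<open>d\<close>.\<close>

locale ranked_parent =
  fixes V :: "'v set" and \<rho> :: 'v and \<pi> :: "'v \<Rightarrow> 'v" and d :: "'v \<Rightarrow> nat"
  assumes finite_V: "finite V"
    and root_in: "\<rho> \<in> V"
    and parent_in: "v \<in> V \<Longrightarrow> v \<noteq> \<rho> \<Longrightarrow> \<pi> v \<in> V"
    and parent_less: "v \<in> V \<Longrightarrow> v \<noteq> \<rho> \<Longrightarrow> d (\<pi> v) < d v"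
begin

abbreviation "T \<equiv> parent_tree V \<rho> \<pi>"

lemma pverts_T: "pverts T = V"
  by (simp add: parent_tree_def)

lemma parcs_T: "(v, w) \<in> parcs T \<longleftrightarrow> v \<in> V - {\<rho>} \<and> w = \<pi> v \<or> w \<in> V - {\<rho>} \<and> v = \<pi> w"
  by (simp add: parent_tree_def)

lemma parcs_T_parent: "v \<in> V \<Longrightarrow> v \<noteq> \<rho> \<Longrightarrow> (v, \<pi> v) \<in> parcs T"
  by (simp add: parcs_T)

lemma parcs_T_in: "(v, w) \<in> parcs T \<Longrightarrow> v \<in> V \<and> w \<in> V"
  using parent_in by (auto simp: parcs_T)

lemma pair_graph_T: "pair_graph T"
proof -
  have "parcs T \<subseteq> V \<times> V" using parcs_T_in by auto
  then have "finite (parcs T)" using finite_V by (meson finite_SigmaI finite_subset)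
  moreover have "v \<noteq> w" if "(v, w) \<in> parcs T" for v w
    using that parent_less by (fastforce simp: parcs_T)
  moreover have "symmetric (with_proj T)"
    by (auto simp: symmetric_def sym_def parcs_T)
  ultimately show ?thesis
    using parcs_T_in finite_V by unfold_locales (auto simp: pverts_T)
qed

sublocale T: pair_graph T
  by (rule pair_graph_T)

lemma walk_to_root: "v \<in> V \<Longrightarrow> \<exists>p. T.awalk v p \<rho> \<and> length p \<le> d v"
proof (induction "d v" arbitrary: v rule: less_induct)
  case less
  show ?case
  proof (cases "v = \<rho>")
    case True
    then show ?thesis using root_in by (intro exI[of _ "[]"]) (simp add: T.awalk_Nil_iff pverts_T)
  next
    case False
    then have lt: "d (\<pi> v) < d v" and "\<pi> v \<in> V" using less.prems parent_in parent_less by auto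
    from less.hyps[OF this] obtain p where "T.awalk (\<pi> v) p \<rho>" "length p \<le> d (\<pi> v)" by blast
    then show ?thesis using lt parcs_T_parent[OF less.prems False]
      by (intro exI[of _ "(v, \<pi> v) # p"])
        (auto simp: T.awalk_Cons_iff pverts_T less.prems)
  qed
qed

text \<open>The two walks to the root are joined there, the second one reversed.\<close>

lemma walk_between:
  assumes "u \<in> V" "v \<in> V"
  shows "\<exists>p. T.awalk u p v \<and> length p \<le> d u + d v"
proof -
  from assms obtain p q where p: "T.awalk u p \<rho>" "length p \<le> d u"
    and q: "T.awalk v q \<rho>" "length q \<le> d v" using walk_to_root by meson
  have len: "length (rev_path q) = length q" by (induction q) auto
  from p q have "T.awalk u (p @ rev_path q) v" by (auto intro: T.awalk_appendI)
  with p q len show ?thesis by (intro exI[of _ "p @ rev_path q"]) auto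
qed

lemma graph_diameter_T:
  assumes "\<And>v. v \<in> V \<Longrightarrow> d v \<le> k"
  shows "graph_diameter (with_proj T) \<le> 2 * k"
proof -
  have "graph_dist (with_proj T) u v \<le> 2 * k" if uv: "u \<in> V" "v \<in> V" for u v
  proof -
    from walk_between[OF uv] obtain p where p: "T.awalk u p v" "length p \<le> d u + d v" by blast
    from p(1) have "graph_dist (with_proj T) u v \<le> length p"
      unfolding graph_dist_def by (intro Least_le) blast
    with p(2) assms[OF uv(1)] assms[OF uv(2)] show ?thesis by linarith
  qed
  then show ?thesis
    unfolding graph_diameter_def using finite_V root_in
    by (subst Max_le_iff) (auto simp: pverts_T)
qed

lemma connected_T: "Digraph_Component.connected (with_proj T)"
proof -
  have "u \<rightarrow>\<^sup>*\<^bsub>with_proj T\<^esub> v" if "u \<in> V" "v \<in> V" for u v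
    using walk_between[OF that] unfolding T.reachable_awalk by blast
  then have "strongly_connected (with_proj T)"
    using root_in by (intro strongly_connectedI) (auto simp: pverts_T)
  then show ?thesis
    by (simp add: Digraph_Component.connected_def T.mk_symmetric_eq)
qed

text \<open>Every neighbour other than the parent is a child and has larger rank, so both
  \<open>a\<close> and \<open>b\<close> are the parent of \<open>w\<close>.\<close>

lemma neighbour_le_unique:
  assumes "(a, w) \<in> parcs T" "(w, b) \<in> parcs T" "d a \<le> d w" "d b \<le> d w"
  shows "a = b"
  using assms parent_less by (fastforce simp: parcs_T)

text \<open>A vertex of maximal rank on a cycle has its parent as both of its neighbours.\<close>

lemma acyclic_T:
  assumes "T.cycle c"
  shows "length c < 3"
proof (rule ccontr)
  assume "\<not> length c < 3"
  define L where "L = length c"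
  from \<open>\<not> length c < 3\<close> have L: "3 \<le> L" by (simp add: L_def)
  from assms obtain u where w: "T.awalk u c u" and dist: "distinct (tl (pawalk_verts u c))"
    unfolding T.cycle_def by auto
  define vs where "vs = pawalk_verts u c"
  have len: "length vs = Suc L" using T.length_awalk_verts[of u c] by (simp add: vs_def L_def)
  have arc: "(vs ! k, vs ! Suc k) \<in> parcs T" if "k < L" for k
  proof -
    have "c ! k = (vs ! k, vs ! Suc k)"
      unfolding vs_def by (rule nth_pcas) (use w that in \<open>auto simp: T.awalk_def L_def\<close>)
    moreover have "c ! k \<in> set c" using that by (simp add: L_def)
    moreover have "set c \<subseteq> parcs T" using w by (simp add: T.awalk_def)
    ultimately show ?thesis by auto
  qed
  have ends: "vs ! 0 = vs ! L"
  proof -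
    have "hd vs = u" "last vs = u"
      using w unfolding vs_def T.awalk_conv by blast+
    moreover have "vs \<noteq> []" using len by auto
    ultimately show ?thesis using len by (simp add: hd_conv_nth last_conv_nth)
  qed
  have inj: "a = b" if "vs ! a = vs ! b" "1 \<le> a" "a \<le> L" "1 \<le> b" "b \<le> L" for a b
  proof -
    have "tl vs ! (a - 1) = tl vs ! (b - 1)" using that len by (simp add: nth_tl)
    then have "a - 1 = b - 1" using dist that len
      by (subst (asm) nth_eq_iff_index_eq) (auto simp: vs_def)
    with that show ?thesis by simp
  qed
  define D where "D = (\<lambda>j. d (vs ! j)) ` {1..L}"
  have "Max D \<in> D" using L by (intro Max_in) (auto simp: D_def)
  then obtain k where k: "k \<in> {1..L}" and "d (vs ! k) = Max D" by (auto simp: D_def)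
  then have max: "d (vs ! j) \<le> d (vs ! k)" if "j \<in> {1..L}" for j
    using that by (auto simp: D_def intro!: Max_ge)
  \<comment> \<open>Positions run cyclically through \<open>{1..L}\<close>, since position 0 repeats
    position \<open>L\<close>. The two positions next to \<open>k\<close> are \<open>a\<close> and
    \<open>b\<close>; they differ because \<open>3 \<le> L\<close>.\<close>
  define a where "a = (if k = 1 then L else k - 1)"
  define b where "b = (if k = L then 1 else Suc k)"
  have ab: "a \<in> {1..L}" "b \<in> {1..L}" "a \<noteq> b" using k L by (auto simp: a_def b_def split: if_splits)
  have "(vs ! a, vs ! k) \<in> parcs T"
    using arc[of "k - 1"] k ends L by (auto simp: a_def)
  moreover have "(vs ! k, vs ! b) \<in> parcs T"
    using arc[of k] arc[of 0] k ends L by (auto simp: b_def)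
  ultimately have "vs ! a = vs ! b" using neighbour_le_unique max ab by blast
  then show False using inj ab by auto
qed

lemma undirected_tree_T: "undirected_tree T"
  unfolding undirected_tree_def using pair_graph_T connected_T acyclic_T by fastforce

text \<open>The path enters and leaves \<open>w\<close> through different neighbours. At most one of
  them is the parent of \<open>w\<close>, so another is a child.\<close>

lemma inner_vertex_has_child:
  assumes p: "T.apath u p v" and w: "w \<in> set (pawalk_verts u p)" "w \<noteq> u" "w \<noteq> v"
  shows "\<exists>x \<in> V - {\<rho>}. w = \<pi> x"
proof -
  have "pcas u p v" using p by (auto simp: T.apath_def T.awalk_def)
  then have "\<exists>a. (a, w) \<in> set p" using w
  proof (induction p arbitrary: u)
    case (Cons e es)
    show ?case
    proof (cases "w = snd e")
      case True
      then show ?thesis by (metis list.set_intros(1) prod.collapse)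
    next
      case False
      with Cons show ?thesis by auto
    qed
  qed auto
  then obtain a where "(a, w) \<in> set p" by blast
  from T.apath_succ_decomp[OF p this w(3)] obtain p1 z p2
    where eq: "p = p1 @ (a, w) # (w, z) # p2" and "a \<noteq> z" by blast
  have "set p \<subseteq> parcs T" using p by (auto simp: T.apath_def T.awalk_def)
  then have "(a, w) \<in> parcs T" "(w, z) \<in> parcs T" using eq by auto
  with \<open>a \<noteq> z\<close> show ?thesis by (auto simp: parcs_T)
qed

end

text \<open>Inner vertices of paths are parents, so they lie in the disjoint sets \<open>C\<close>
  and \<open>C'\<close>. A common edge would be a parent edge of both trees; its two parent ends
  cannot coincide, so each end would be the parent of the other, which \<open>no_swap\<close>
  forbids.\<close>

lemma ranked_parent_disjoint_parents_completely_independent: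
  assumes 1: "ranked_parent V \<rho> \<pi> d" and 2: "ranked_parent V \<rho>' \<pi>' d'"
    and C: "\<And>v. v \<in> V - {\<rho>} \<Longrightarrow> \<pi> v \<in> C" and C': "\<And>v. v \<in> V - {\<rho>'} \<Longrightarrow> \<pi>' v \<in> C'"
    and disj: "C \<inter> C' = {}"
    and no_swap: "\<And>u v. u \<in> C \<Longrightarrow> v \<in> C' \<Longrightarrow> v \<in> V \<Longrightarrow> u \<in> V \<Longrightarrow> \<pi> v = u \<Longrightarrow> \<pi>' u = v \<Longrightarrow> False"
  shows "completely_independent (parent_tree V \<rho> \<pi>) (parent_tree V \<rho>' \<pi>')"
proof -
  interpret S: ranked_parent V \<rho> \<pi> d by (fact 1)
  interpret S': ranked_parent V \<rho>' \<pi>' d' by (fact 2)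
  have no_common: "False"
    if v: "v \<in> V - {\<rho>}" "(v, \<pi> v) \<in> parcs S'.T" for v
  proof -
    have "\<pi> v \<in> C" using C v(1) .
    consider "v \<in> V - {\<rho>'}" "\<pi> v = \<pi>' v" | "\<pi> v \<in> V - {\<rho>'}" "v = \<pi>' (\<pi> v)"
      using v(2) unfolding S'.parcs_T by blast
    then show False
    proof cases
      case 1
      with C'[of v] \<open>\<pi> v \<in> C\<close> disj show False by auto
    next
      case 2
      with C'[of "\<pi> v"] have "v \<in> C'" by simp
      with 2 v(1) \<open>\<pi> v \<in> C\<close> show False by (intro no_swap[of "\<pi> v" v]) auto
    qed
  qed
  have arcs: "False" if "(a, b) \<in> parcs S.T" "(a, b) \<in> parcs S'.T" for a b
  proof -
    have "(b, a) \<in> parcs S'.T" using that(2) by (rule S'.T.arcs_symmetric)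
    then show False using that no_common unfolding S.parcs_T by blast
  qed
  have paths: "w \<in> {u, v}"
    if pq: "S.T.apath u p v" "S'.T.apath u q v"
      "w \<in> set (pawalk_verts u p)" "w \<in> set (pawalk_verts u q)" for u v p q w
  proof (rule ccontr)
    assume "w \<notin> {u, v}"
    then obtain x x' where x: "x \<in> V - {\<rho>}" "w = \<pi> x" and x': "x' \<in> V - {\<rho>'}" "w = \<pi>' x'"
      using S.inner_vertex_has_child[OF pq(1,3)] S'.inner_vertex_has_child[OF pq(2,4)] by blast
    have "w \<in> C" "w \<in> C'" using C[OF x(1)] C'[OF x'(1)] by (simp_all only: x(2)[symmetric] x'(2)[symmetric])
    then show False using disj by blast
  qed
  show ?thesis
    unfolding completely_independent_def
  proof (intro conjI allI impI subsetI)
    show "parcs S.T \<inter> parcs S'.T = {}" using arcs by auto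
  next
    fix u v p q w
    assume "S.T.apath u p v" "S'.T.apath u q v"
      "w \<in> set (pawalk_verts u p) \<inter> set (pawalk_verts u q)"
    then show "w \<in> {u, v}" by (intro paths) auto
  qed
qed

text \<open>Inside \<open>C\<close> the parents follow shortest \<open>R\<close>-chains to the root;
  all other vertices become leaves attached by \<open>a\<close>.\<close>

lemma ranked_parent_exists:
  assumes fin: "finite V" and CV: "C \<subseteq> V" and root: "\<rho> \<in> C"
    and R: "\<And>v w. R v w \<Longrightarrow> w \<in> C"
    and reach: "\<And>v. v \<in> C \<Longrightarrow> \<exists>l\<le>K. (R ^^ l) v \<rho>"
    and att: "\<And>v. v \<in> V - C \<Longrightarrow> a v \<in> C"
  shows "\<exists>\<pi> d. ranked_parent V \<rho> \<pi> d \<and> (\<forall>v\<in>V. d v \<le> Suc K) \<and>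
    (\<forall>v\<in>C - {\<rho>}. R v (\<pi> v)) \<and> (\<forall>v\<in>V - C. \<pi> v = a v)"
proof -
  define e where "e v = (LEAST l. (R ^^ l) v \<rho>)" for v
  have e: "(R ^^ e v) v \<rho> \<and> e v \<le> K" if "v \<in> C" for v
  proof -
    from reach[OF that] obtain l where l: "l \<le> K" "(R ^^ l) v \<rho>" by blast
    have "(R ^^ e v) v \<rho>" unfolding e_def using l(2) by (rule LeastI)
    moreover have "e v \<le> l" unfolding e_def using l(2) by (rule Least_le)
    ultimately show ?thesis using l(1) by simp
  qed
  have next_ex: "\<exists>w. R v w \<and> e w < e v" if "v \<in> C" "v \<noteq> \<rho>" for v
  proof (cases "e v")
    case 0
    with e[OF that(1)] that(2) show ?thesis by auto
  next
    case (Suc l)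
    with e[OF that(1)] obtain w where w: "R v w" "(R ^^ l) w \<rho>"
      by (metis relpowp_Suc_E2)
    then have "e w \<le> l" unfolding e_def by (intro Least_le)
    with w Suc show ?thesis by auto
  qed
  define \<pi> where "\<pi> v = (if v \<in> C then SOME w. R v w \<and> e w < e v else a v)" for v
  \<comment> \<open>Ranks inside \<open>C\<close> are at most \<open>K\<close>, so
    \<open>Suc K\<close> places the attached leaves above every possible parent.\<close>
  define d where "d v = (if v \<in> C then e v else Suc K)" for v
  have \<pi>: "R v (\<pi> v) \<and> e (\<pi> v) < e v" if "v \<in> C" "v \<noteq> \<rho>" for v
    using someI_ex[OF next_ex[OF that]] that by (simp add: \<pi>_def)
  have \<pi>C: "\<pi> v \<in> C" if "v \<in> V - {\<rho>}" for v
    using \<pi> R att that by (cases "v \<in> C") (auto simp: \<pi>_def)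
  have "ranked_parent V \<rho> \<pi> d"
  proof
    show "d (\<pi> v) < d v" if "v \<in> V" "v \<noteq> \<rho>" for v
      using \<pi>C[of v] \<pi>[of v] e[of "\<pi> v"] that by (auto simp: d_def)
  qed (use fin root CV \<pi>C in auto)
  moreover have "\<forall>v\<in>V. d v \<le> Suc K" using e by (auto simp: d_def le_SucI)
  moreover have "\<forall>v\<in>V - C. \<pi> v = a v" by (simp add: \<pi>_def)
  ultimately show ?thesis using \<pi> by (intro exI[of _ \<pi>] exI[of _ d]) simp
qed

section \<open>XOR sums\<close>

unbundle bit_operations_syntax

primrec xor_sum :: "(nat \<Rightarrow> nat) \<Rightarrow> nat \<Rightarrow> nat" where
  "xor_sum f 0 = 0"
| "xor_sum f (Suc n) = xor_sum f n XOR f n"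

lemma xor_sum_cong: "(\<And>j. j < n \<Longrightarrow> f j = g j) \<Longrightarrow> xor_sum f n = xor_sum g n"
  by (induction n) auto

lemma xor_sum_update:
  assumes "j < n" "f j = g j XOR a" "\<And>k. k < n \<Longrightarrow> k \<noteq> j \<Longrightarrow> f k = g k"
  shows "xor_sum f n = xor_sum g n XOR a"
  using assms
proof (induction n)
  case (Suc n)
  show ?case
  proof (cases "j = n")
    case True
    have "xor_sum f n = xor_sum g n" using Suc.prems(3) True by (intro xor_sum_cong) simp
    with Suc.prems(2) True show ?thesis by (simp add: xor.assoc)
  next
    case False
    then have "xor_sum f n = xor_sum g n XOR a" "f n = g n"
      using Suc.prems by (auto intro: Suc.IH)
    then show ?thesis by (simp add: xor.assoc xor.commute[of a])
  qed
qed simp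

lemma xor_sum_zero: "(\<And>j. j < n \<Longrightarrow> f j = 0) \<Longrightarrow> xor_sum f n = 0"
  by (induction n) auto

lemma xor_less_power:
  fixes a b :: nat
  assumes "a < 2 ^ k" "b < 2 ^ k"
  shows "a XOR b < 2 ^ k"
  using assms by (metis take_bit_nat_eq_self_iff take_bit_xor)

lemma xor_sum_less: "(\<And>j. j < n \<Longrightarrow> f j < 2 ^ k) \<Longrightarrow> xor_sum f n < 2 ^ k"
  by (induction n) (auto intro: xor_less_power)

lemma xor_mod_4: "(a XOR b) mod 4 = (a mod 4) XOR (b mod 4 :: nat)"
  using take_bit_xor[of 2 a b] by (simp add: take_bit_eq_mod)

lemma xor_cancel: "a XOR (a XOR b) = (b :: nat)"
  by (simp flip: xor.assoc)

section \<open>Colouring the power\<close>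

text \<open>The bound \<open>dimension\<close> provides 9 coordinates for flag and types,
  \<open>2 ^ m\<close> for the colour and at least four times as many for the syndrome, so that
  every syndrome value occurs as a label.\<close>

locale neighbour_depth = H: pair_graph H
  for H :: "'a pair_pre_digraph" +
  fixes c :: 'a and nb :: "'a \<Rightarrow> 'a" and dep :: "'a \<Rightarrow> nat" and r :: nat and m n :: nat
  assumes root_vertex: "c \<in> pverts H"
    and dep_root: "dep c = 0"
    and nb_arc: "a \<in> pverts H \<Longrightarrow> (a, nb a) \<in> parcs H"
    and dep_nb: "a \<in> pverts H \<Longrightarrow> a \<noteq> c \<Longrightarrow> dep a = Suc (dep (nb a))"
    and dep_nb_root: "dep (nb c) = 1"
    and dep_le: "a \<in> pverts H \<Longrightarrow> dep a \<le> r"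
    and dimension: "9 + 5 * 2 ^ m \<le> n"
begin

abbreviation M :: nat where "M \<equiv> 2 ^ m"

section \<open>Vertices of the power, flips and syndromes\<close>

definition W :: "'a list set" where
  "W = {v. length v = n \<and> set v \<subseteq> pverts H}"

definition flip :: "nat \<Rightarrow> 'a list \<Rightarrow> 'a list" where
  "flip j v = v[j := nb (v ! j)]"

definition depth_sum :: "'a list \<Rightarrow> nat" where
  "depth_sum v = (\<Sum>j<n. dep (v ! j))"

definition syn :: "(nat \<Rightarrow> nat) \<Rightarrow> 'a list \<Rightarrow> nat" where
  "syn lab v = xor_sum (\<lambda>j. if odd (dep (v ! j)) then lab j else 0) n"

text \<open>
  Coordinate 0 carries the flag, the next two blocks of four the types, then come \<open>M\<close> coordinates for
  the colour, and all others belong to the syndrome. As each list of labels is complete, every component of the state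
  can be set to any value by a single flip.
\<close>

abbreviation lab_w :: "nat \<Rightarrow> nat" where "lab_w j \<equiv> if j = 0 then 1 else 0"
abbreviation lab_p :: "nat \<Rightarrow> nat" where "lab_p j \<equiv> if 1 \<le> j \<and> j < 5 then j - 1 else 0"
abbreviation lab_q :: "nat \<Rightarrow> nat" where "lab_q j \<equiv> if 5 \<le> j \<and> j < 9 then j - 5 else 0"
abbreviation lab_k :: "nat \<Rightarrow> nat" where "lab_k j \<equiv> if 9 \<le> j \<and> j < 9 + M then j - 9 else 0"
abbreviation lab_s :: "nat \<Rightarrow> nat" where
  "lab_s j \<equiv> if 9 + M \<le> j then (j - (9 + M)) mod (4 * M) else 0"

definition "sw = syn lab_w"
definition "sp = syn lab_p"
definition "sq = syn lab_q"
definition "sk = syn lab_k"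
definition "ss = syn lab_s"

definition col :: "'a list \<Rightarrow> nat" where
  "col v = (if sw v = 0 \<and> ss v mod 4 \<in> {sp v, sq v} then sk v else ss v div 4)"

section \<open>The effect of a flip on the state\<close>

lemma nb_vertex: "a \<in> pverts H \<Longrightarrow> nb a \<in> pverts H"
  using nb_arc H.in_arcsD2 by blast

lemma W_nth: "v \<in> W \<Longrightarrow> j < n \<Longrightarrow> v ! j \<in> pverts H"
  by (auto simp: W_def)

lemma length_W: "v \<in> W \<Longrightarrow> length v = n"
  by (simp add: W_def)

lemma flip_W: "v \<in> W \<Longrightarrow> flip j v \<in> W"
proof (cases "j < n")
  case True
  assume "v \<in> W"
  then have "set (v[j := nb (v ! j)]) \<subseteq> pverts H"
    using True W_nth nb_vertex by (intro set_update_subsetI) (auto simp: W_def)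
  with \<open>v \<in> W\<close> show ?thesis by (simp add: W_def flip_def)
qed (simp add: W_def flip_def list_update_beyond)

lemma flip_nth_other: "k \<noteq> j \<Longrightarrow> flip j v ! k = v ! k"
  by (simp add: flip_def)

lemma flip_nth: "v \<in> W \<Longrightarrow> j < n \<Longrightarrow> flip j v ! j = nb (v ! j)"
  by (simp add: flip_def length_W)

lemma even_dep_nb: "a \<in> pverts H \<Longrightarrow> even (dep (nb a)) \<longleftrightarrow> odd (dep a)"
  using dep_nb[of a] dep_nb_root dep_root by (cases "a = c") auto

text \<open>Passing to the chosen neighbour changes the parity of one depth, so exactly the label of
  this coordinate enters or leaves the XOR.\<close>

lemma syn_flip:
  assumes "v \<in> W" "j < n"
  shows "syn lab (flip j v) = syn lab v XOR lab j"
  unfolding syn_def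
  using assms even_dep_nb[OF W_nth[OF assms]]
  by (intro xor_sum_update[of j]) (auto simp: flip_nth flip_nth_other)

lemmas state_flip = syn_flip[of _ _ lab_w, folded sw_def] syn_flip[of _ _ lab_p, folded sp_def]
  syn_flip[of _ _ lab_q, folded sq_def] syn_flip[of _ _ lab_k, folded sk_def]
  syn_flip[of _ _ lab_s, folded ss_def]

lemma syn_less: "(\<And>j. lab j < 2 ^ k) \<Longrightarrow> syn lab v < 2 ^ k"
  unfolding syn_def by (intro xor_sum_less) auto

lemma syn_zero:
  assumes "\<And>j. j < n \<Longrightarrow> lab j \<noteq> 0 \<Longrightarrow> v ! j = c"
  shows "syn lab v = 0"
  unfolding syn_def
proof (rule xor_sum_zero)
  fix j assume "j < n"
  with assms[OF this] dep_root show "(if odd (dep (v ! j)) then lab j else 0) = 0"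
    by (cases "lab j = 0") auto
qed

lemma sp_less: "sp v < 4" and sq_less: "sq v < 4" and sw_less: "sw v < 2"
  unfolding sp_def sq_def sw_def
  by (rule syn_less[of _ 2, simplified] syn_less[of _ 1, simplified]; simp add: less_diff_conv2)+

lemma ss_less: "ss v < 4 * M"
  unfolding ss_def using syn_less[of lab_s "m + 2" v] by (auto simp: power_add)

lemma xor_less_4: "a < 4 \<Longrightarrow> b < 4 \<Longrightarrow> a XOR b < (4 :: nat)"
  using xor_less_power[of a 2 b] by simp

lemma xor_less_4M: "a < 4 * M \<Longrightarrow> b < 4 * M \<Longrightarrow> a XOR b < 4 * M"
  using xor_less_power[of a "m + 2" b] by (simp add: power_add)

lemma set_w:
  assumes "v \<in> W"
  shows "sw (flip 0 v) = sw v XOR 1" "sp (flip 0 v) = sp v" "sq (flip 0 v) = sq v"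
    "sk (flip 0 v) = sk v" "ss (flip 0 v) = ss v"
  using assms dimension by (simp_all add: state_flip)

text \<open>The flipped coordinate carries the label \<open>sp v XOR t\<close>, which cancels
  \<open>sp v\<close> and leaves \<open>t\<close>; its labels for the other components are
  0.\<close>

lemma set_p:
  assumes "v \<in> W" "t < 4"
  defines "u \<equiv> flip (1 + (sp v XOR t)) v"
  shows "sw u = sw v" "sp u = t" "sq u = sq v" "sk u = sk v" "ss u = ss v"
  using assms(1) dimension xor_less_4[OF sp_less[of v] assms(2)]
  unfolding u_def by (simp_all add: state_flip xor_cancel)

lemma set_q:
  assumes "v \<in> W" "t < 4"
  defines "u \<equiv> flip (5 + (sq v XOR t)) v"
  shows "sw u = sw v" "sp u = sp v" "sq u = t" "sk u = sk v" "ss u = ss v"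
  using assms(1) dimension xor_less_4[OF sq_less[of v] assms(2)]
  unfolding u_def by (simp_all add: state_flip xor_cancel)

text \<open>Here the coordinate is prescribed rather than the new value: on the way to
  \<open>root i\<close> it has to be \<open>9 + i\<close>, where \<open>root i\<close> differs from
  the centre, and it is flipped while \<open>sk\<close> is 0.\<close>

lemma set_k:
  assumes "v \<in> W" "t < M"
  defines "u \<equiv> flip (9 + t) v"
  shows "sw u = sw v" "sp u = sp v" "sq u = sq v" "sk u = sk v XOR t" "ss u = ss v"
  using assms(1,2) dimension
  unfolding u_def by (simp_all add: state_flip)

lemma set_s:
  assumes "v \<in> W" "t < 4 * M"
  defines "u \<equiv> flip (9 + M + (ss v XOR t)) v"
  shows "sw u = sw v" "sp u = sp v" "sq u = sq v" "sk u = sk v" "ss u = t"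
  using assms(1) dimension xor_less_4M[OF ss_less[of v] assms(2)]
  unfolding u_def by (simp_all add: state_flip xor_cancel)

section \<open>The depth sum as a potential\<close>

lemma depth_sum_flip:
  assumes "v \<in> W" "j < n"
  shows "depth_sum (flip j v) + dep (v ! j) = depth_sum v + dep (nb (v ! j))"
proof -
  have "depth_sum u = dep (u ! j) + (\<Sum>k\<in>{..<n} - {j}. dep (u ! k))" for u
    unfolding depth_sum_def using assms by (intro sum.remove) auto
  then show ?thesis using assms by (simp add: flip_nth flip_nth_other)
qed

lemma depth_sum_flip_le: "v \<in> W \<Longrightarrow> j < n \<Longrightarrow> depth_sum (flip j v) \<le> Suc (depth_sum v)"
  using depth_sum_flip[of v j] dep_nb[OF W_nth, of v j] dep_nb_root
  by (cases "v ! j = c") (auto simp: dep_root)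

lemma depth_sum_flip_less:
  "v \<in> W \<Longrightarrow> j < n \<Longrightarrow> v ! j \<noteq> c \<Longrightarrow> depth_sum v = Suc (depth_sum (flip j v))"
  using depth_sum_flip[of v j] dep_nb[OF W_nth, of v j] by auto

lemma depth_sum_le: "v \<in> W \<Longrightarrow> depth_sum v \<le> n * r"
  unfolding depth_sum_def using sum_bounded_above[of "{..<n}" "\<lambda>j. dep (v ! j)" r] dep_le W_nth
  by auto

section \<open>Colour classes and moves inside them\<close>

definition C :: "nat \<Rightarrow> 'a list set" where
  "C i = {v \<in> W. col v = i}"

definition step :: "nat \<Rightarrow> 'a list \<Rightarrow> 'a list \<Rightarrow> bool" where
  "step i v u \<longleftrightarrow> v \<in> C i \<and> u \<in> C i \<and> (\<exists>j<n. u = flip j v)"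

text \<open>
  The potential makes steps towards the centre free, so \<open>e\<close> counts twice the number of other steps.
\<close>

definition move :: "nat \<Rightarrow> nat \<Rightarrow> 'a list \<Rightarrow> 'a list \<Rightarrow> bool" where
  "move i e v u \<longleftrightarrow> (\<exists>l. (step i ^^ l) v u \<and> l + depth_sum u \<le> depth_sum v + e)"

lemma move_refl: "move i e v v"
  unfolding move_def by (intro exI[of _ 0]) simp

lemma move_trans:
  assumes "move i e v u" "move i e' u w"
  shows "move i (e + e') v w"
proof -
  from assms obtain l l' where "(step i ^^ l) v u" "l + depth_sum u \<le> depth_sum v + e"
    and "(step i ^^ l') u w" "l' + depth_sum w \<le> depth_sum u + e'"
    unfolding move_def by blast
  then show ?thesis
    unfolding move_def by (intro exI[of _ "l + l'"]) (auto simp: relpowp_add)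
qed

text \<open>One step and a rise of the potential by at most one use up the allowance 2.\<close>

lemma move_flip: "v \<in> C i \<Longrightarrow> flip j v \<in> C i \<Longrightarrow> j < n \<Longrightarrow> move i 2 v (flip j v)"
  unfolding move_def using depth_sum_flip_le[of v j]
  by (intro exI[of _ 1]) (auto simp: step_def C_def relpowp_1 simp del: One_nat_def)

lemma move_flip_down:
  "v \<in> C i \<Longrightarrow> flip j v \<in> C i \<Longrightarrow> j < n \<Longrightarrow> v ! j \<noteq> c \<Longrightarrow> move i 0 v (flip j v)"
  unfolding move_def using depth_sum_flip_less[of v j]
  by (intro exI[of _ 1]) (auto simp: step_def C_def relpowp_1 simp del: One_nat_def)

text \<open>Flips in \<open>J\<close> stay inside the part of the class described by
  \<open>P\<close>, so each coordinate in \<open>J\<close> can be led along parents to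
  \<open>c\<close>. Every such step lowers the potential and is free.\<close>

lemma clear:
  assumes "J \<subseteq> {..<n}" and "P v"
    and PC: "\<And>u. P u \<Longrightarrow> u \<in> C i"
    and P: "\<And>u j. P u \<Longrightarrow> j \<in> J \<Longrightarrow> P (flip j u)"
  shows "\<exists>u. P u \<and> (\<forall>j\<in>J. u ! j = c) \<and> (\<forall>j. j \<notin> J \<longrightarrow> u ! j = v ! j) \<and> move i 0 v u"
  using \<open>P v\<close>
proof (induction "depth_sum v" arbitrary: v rule: less_induct)
  case less
  show ?case
  proof (cases "\<forall>j\<in>J. v ! j = c")
    case True
    with less.prems show ?thesis using move_refl by blast
  next
    case False
    then obtain j where j: "j \<in> J" "v ! j \<noteq> c" "j < n" using assms(1) by auto
    have Pf: "P (flip j v)" using P less.prems j by blast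
    have "v \<in> W" using PC[OF less.prems] by (simp add: C_def)
    with j have "depth_sum (flip j v) < depth_sum v" using depth_sum_flip_less by simp
    from less.hyps[OF this Pf] obtain u where u: "P u" "\<forall>j\<in>J. u ! j = c"
      "\<forall>k. k \<notin> J \<longrightarrow> u ! k = flip j v ! k" "move i 0 (flip j v) u" by blast
    moreover have "move i 0 v (flip j v)" using PC Pf less.prems j by (intro move_flip_down)
    from move_trans[OF this u(4)] have "move i 0 v u" by simp
    moreover have "\<forall>k. k \<notin> J \<longrightarrow> u ! k = v ! k"
      using u(3) j(1) flip_nth_other by metis
    ultimately show ?thesis by blast
  qed
qed

section \<open>Clearing syndrome coordinates inside a layer\<close>

definition layer :: "nat \<Rightarrow> 'a list \<Rightarrow> bool" where
  "layer i v \<longleftrightarrow> v \<in> W \<and> sw v = 0 \<and> sk v = i \<and> ss v mod 4 \<in> {sp v, sq v}"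

lemma layer_C: "layer i v \<Longrightarrow> v \<in> C i"
  by (auto simp: layer_def C_def col_def)

text \<open>As 4 divides \<open>4 * M\<close>, these are the syndrome coordinates whose label has
  type \<open>d\<close>.\<close>

definition block :: "nat \<Rightarrow> nat set" where
  "block d = {j. 9 + M \<le> j \<and> j < n \<and> (j - (9 + M)) mod 4 = d}"

text \<open>A flip in the block XORs the current type with \<open>d\<close>. As \<open>sp\<close>
  and \<open>sq\<close> differ by \<open>d\<close>, the current type passes from one of them to the
  other, or stays for \<open>d = 0\<close>, so the layer is never left.\<close>

lemma clear_block:
  assumes v: "layer i v" "sq v = sp v XOR d"
  shows "\<exists>u. layer i u \<and> (\<forall>j\<in>block d. u ! j = c) \<and> (\<forall>j. j \<notin> block d \<longrightarrow> u ! j = v ! j) \<and> move i 0 v u"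
proof -
  let ?P = "\<lambda>u. layer i u \<and> sq u = sp u XOR d"
  have "?P (flip j u)" if u: "?P u" and j: "j \<in> block d" for u j
  proof -
    have W: "u \<in> W" "j < n" using u j by (auto simp: layer_def block_def)
    have "ss (flip j u) mod 4 = ss u mod 4 XOR d"
      using W j by (auto simp: state_flip xor_mod_4 block_def mod_mod_cancel)
    moreover have "sw (flip j u) = sw u" "sk (flip j u) = sk u" "sp (flip j u) = sp u"
      "sq (flip j u) = sq u"
      using W j by (simp_all add: state_flip block_def)
    moreover have "flip j u \<in> W" using W flip_W by blast
    ultimately show ?thesis using u by (auto simp: layer_def xor.assoc)
  qed
  moreover have "block d \<subseteq> {..<n}" by (auto simp: block_def)
  ultimately have "\<exists>u. ?P u \<and> (\<forall>j\<in>block d. u ! j = c) \<and> (\<forall>j. j \<notin> block d \<longrightarrow> u ! j = v ! j) \<and> move i 0 v u"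
    using v layer_C by (intro clear) auto
  then show ?thesis by blast
qed

text \<open>One of \<open>sp\<close> and \<open>sq\<close> equals the current type; a single flip
  resets the other so that the two differ by \<open>d\<close>, and \<open>clear_block\<close>
  applies. That flip disturbs a coordinate in \<open>{1..<9}\<close>.\<close>

lemma layer_clear:
  assumes v: "layer i v" and d: "d < 4"
  shows "\<exists>u. layer i u \<and> (\<forall>j\<in>block d. u ! j = c) \<and>
    (\<forall>j. j \<notin> block d \<and> j \<notin> {1..<9} \<longrightarrow> u ! j = v ! j) \<and> move i 2 v u"
proof -
  have W: "v \<in> W" using v by (simp add: layer_def)
  have "\<exists>j\<in>{1..<9}. layer i (flip j v) \<and> sq (flip j v) = sp (flip j v) XOR d"
  proof (cases "ss v mod 4 = sp v")
    case True
    let ?t = "sp v XOR d"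
    have t: "?t < 4" using xor_less_4 sp_less d by blast
    show ?thesis
      using True v set_q[OF W t] xor_less_4[OF sq_less[of v] t] flip_W[OF W]
      by (intro bexI[of _ "5 + (sq v XOR ?t)"]) (auto simp: layer_def)
  next
    case False
    then have q: "ss v mod 4 = sq v" using v by (simp add: layer_def)
    let ?t = "sq v XOR d"
    have t: "?t < 4" using xor_less_4 sq_less d by blast
    show ?thesis
      using q v set_p[OF W t] xor_less_4[OF sp_less[of v] t] flip_W[OF W]
      by (intro bexI[of _ "1 + (sp v XOR ?t)"]) (auto simp: layer_def xor.assoc)
  qed
  then obtain j where j: "j \<in> {1..<9}" "layer i (flip j v)" "sq (flip j v) = sp (flip j v) XOR d"
    by blast
  from clear_block[OF j(2,3)] obtain u where u: "layer i u" "\<forall>k\<in>block d. u ! k = c"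
    "\<forall>k. k \<notin> block d \<longrightarrow> u ! k = flip j v ! k" "move i 0 (flip j v) u" by blast
  have "move i 2 v (flip j v)"
    using v j layer_C dimension by (intro move_flip) auto
  from move_trans[OF this u(4)] have "move i 2 v u" by simp
  moreover have "\<forall>k. k \<notin> block d \<and> k \<notin> {1..<9} \<longrightarrow> u ! k = v ! k"
    using u(3) j(1) flip_nth_other by metis
  ultimately show ?thesis using u by blast
qed

section \<open>Colour classes have small radius\<close>

text \<open>The constant vertex \<open>c\<close> has state 0 throughout. The one displaced
  coordinate has colour label \<open>i\<close>, so \<open>sk\<close> becomes \<open>i\<close> while
  flag, types and syndrome stay 0, and the vertex lies in the layer of \<open>i\<close>.\<close>

definition root :: "nat \<Rightarrow> 'a list" where
  "root i = (replicate n c)[9 + i := nb c]"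

text \<open>The new syndrome \<open>t\<close> has quotient \<open>i\<close> and the old type.
  Keeping the type preserves whether the vertex is recoloured: if so, its colour is still
  \<open>sk v\<close>; if not, it is now the quotient \<open>i\<close>.\<close>

lemma route_to_residue:
  assumes i: "i < M" and v: "v \<in> C i"
  shows "\<exists>u\<in>C i. ss u div 4 = i \<and> move i 2 v u"
proof -
  have W: "v \<in> W" using v by (simp add: C_def)
  define t where "t = 4 * i + ss v mod 4"
  have t: "t < 4 * M" "t mod 4 = ss v mod 4" "t div 4 = i" using i by (auto simp: t_def)
  define u where "u = flip (9 + M + (ss v XOR t)) v"
  note state = set_s[OF W t(1), folded u_def]
  have "u \<in> W" unfolding u_def using flip_W[OF W] .
  then have "u \<in> C i" using v state t by (auto simp: C_def col_def)
  moreover have "9 + M + (ss v XOR t) < n"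
    using xor_less_4M[OF ss_less[of v] t(1)] dimension by simp
  ultimately show ?thesis using v state t move_flip[of v i "9 + M + (ss v XOR t)"]
    unfolding u_def by (intro bexI[of _ u]) (auto simp: u_def)
qed

text \<open>Flag 1 switches recolouring off, and the basic colour is already
  \<open>i\<close>.\<close>

lemma route_to_flag:
  assumes v: "v \<in> C i" "ss v div 4 = i"
  shows "\<exists>u\<in>W. sw u = 1 \<and> ss u div 4 = i \<and> move i 2 v u"
proof (cases "sw v = 1")
  case True
  with v show ?thesis using move_refl by (auto simp: C_def)
next
  case False
  then have 0: "sw v = 0" using sw_less[of v] by simp
  have W: "v \<in> W" using v by (simp add: C_def)
  note state = set_w[OF W]
  have "flip 0 v \<in> C i" using state 0 v flip_W[OF W] by (simp add: C_def col_def)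
  then show ?thesis
    using move_flip[of v i 0] v state 0 dimension flip_W[OF W] by (intro bexI[of _ "flip 0 v"]) auto
qed

text \<open>At flag 1 the colour depends on the syndrome alone, so the colour coordinates can be
  brought to those of \<open>root i\<close> and \<open>sp\<close> set to the current type. Then the
  flag coordinate can be cleared. Only the flips that set \<open>sk\<close> and \<open>sp\<close>
  are charged, 2 each.\<close>

lemma route_to_layer:
  assumes i: "i < M" and v: "v \<in> W" "sw v = 1" "ss v div 4 = i"
  shows "\<exists>u. layer i u \<and> u ! 0 = c \<and> (\<forall>j\<in>{9..<9 + M}. u ! j = root i ! j) \<and> move i 4 v u"
proof -
  let ?P = "\<lambda>u. u \<in> W \<and> sw u = 1 \<and> ss u div 4 = i"
  have "\<exists>u. ?P u \<and> (\<forall>j\<in>{9..<9 + M}. u ! j = c) \<and>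
      (\<forall>j. j \<notin> {9..<9 + M} \<longrightarrow> u ! j = v ! j) \<and> move i 0 v u"
    using v dimension flip_W by (intro clear) (auto simp: C_def col_def state_flip)
  then obtain u1 where u1: "?P u1" "\<forall>j\<in>{9..<9 + M}. u1 ! j = c" "move i 0 v u1" by blast
  have k1: "sk u1 = 0"
    unfolding sk_def using u1(2) by (intro syn_zero) (auto split: if_splits)
  define u2 where "u2 = flip (9 + i) u1"
  have W1: "u1 \<in> W" using u1 by simp
  note s2 = set_k[OF W1 i, folded u2_def, unfolded k1]
  have W2: "u2 \<in> W" unfolding u2_def using flip_W[OF W1] .
  have u2: "?P u2" using u1 s2 W2 by simp
  have C1: "u1 \<in> C i" and C2: "u2 \<in> C i" using u1(1) u2 by (simp_all add: C_def col_def)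
  have "9 + i < n" using i dimension by simp
  from move_flip[OF C1 _ this] C2 have m2: "move i 2 u1 u2" unfolding u2_def by simp
  have id2: "u2 ! j = root i ! j" if "j \<in> {9..<9 + M}" for j
    using u1(2) that i dimension length_W[OF W1]
    by (cases "j = 9 + i") (auto simp: root_def u2_def flip_def)
  define t where "t = ss u2 mod 4"
  have t: "t < 4" by (simp add: t_def)
  define u3 where "u3 = flip (1 + (sp u2 XOR t)) u2"
  note s3 = set_p[OF W2 t, folded u3_def]
  have W3: "u3 \<in> W" unfolding u3_def using flip_W[OF W2] .
  have j3: "1 + (sp u2 XOR t) < 9" using xor_less_4[OF sp_less[of u2] t] by simp
  have C3: "u3 \<in> C i" using W3 s3(1,5) u2 by (simp add: C_def col_def)
  have "1 + (sp u2 XOR t) < n" using j3 dimension by simp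
  from move_flip[OF C2 _ this] C3 have m3: "move i 2 u2 u3" unfolding u3_def by simp
  have id3: "u3 ! j = root i ! j" if "j \<in> {9..<9 + M}" for j
    using id2[OF that] that j3 by (simp add: u3_def flip_nth_other)
  \<comment> \<open>Under \<open>?Q\<close> the basic colour and the layer colour are both
    \<open>i\<close>, so the flag may take either value on the way.\<close>
  let ?Q = "\<lambda>u. u \<in> W \<and> sk u = i \<and> ss u div 4 = i \<and> sp u = ss u mod 4"
  have "?Q u3" using W3 s3 s2 u2 by (simp add: t_def)
  have "\<exists>u. ?Q u \<and> (\<forall>j\<in>{0}. u ! j = c) \<and> (\<forall>j. j \<notin> {0} \<longrightarrow> u ! j = u3 ! j) \<and> move i 0 u3 u"
  proof (rule clear)
    show "{0} \<subseteq> {..<n}" using dimension by simp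
    show "?Q u3" by fact
    show "u \<in> C i" if "?Q u" for u using that by (simp add: C_def col_def)
    show "?Q (flip j u)" if "?Q u" "j \<in> {0}" for u j using that flip_W by (simp add: set_w)
  qed
  then obtain u4 where u4: "?Q u4" "u4 ! 0 = c" "\<forall>j. j \<noteq> 0 \<longrightarrow> u4 ! j = u3 ! j" "move i 0 u3 u4"
    by auto
  have "sw u4 = 0"
    unfolding sw_def using u4(2) by (intro syn_zero) (auto split: if_splits)
  then have "layer i u4" using u4 by (auto simp: layer_def)
  moreover have "move i 4 v u4"
    using move_trans[OF move_trans[OF move_trans[OF u1(3) m2] m3] u4(4)]
    by (simp add: numeral_eq_Suc)
  ultimately show ?thesis using u4(2,3) id3 by auto
qed

text \<open>The blocks are disjoint, so clearing block \<open>D\<close> keeps the earlier ones at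
  \<open>c\<close>. Only the type coordinates \<open>{1..<9}\<close> are disturbed;
  \<open>route_from_layer\<close> clears them.\<close>

lemma route_in_layer:
  assumes v: "layer i v" and D: "D \<le> 4"
  shows "\<exists>u. layer i u \<and> (\<forall>d<D. \<forall>j\<in>block d. u ! j = c) \<and>
    (\<forall>j. j \<notin> {1..<9} \<and> (\<forall>d<D. j \<notin> block d) \<longrightarrow> u ! j = v ! j) \<and> move i (2 * D) v u"
  using D
proof (induction D)
  case 0
  then show ?case using v move_refl by auto
next
  case (Suc D)
  then obtain u where u: "layer i u" "\<forall>d<D. \<forall>j\<in>block d. u ! j = c"
    "\<forall>j. j \<notin> {1..<9} \<and> (\<forall>d<D. j \<notin> block d) \<longrightarrow> u ! j = v ! j" "move i (2 * D) v u"
    by auto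
  from layer_clear[OF u(1), of D] Suc.prems obtain w where w: "layer i w"
    "\<forall>j\<in>block D. w ! j = c" "\<forall>j. j \<notin> block D \<and> j \<notin> {1..<9} \<longrightarrow> w ! j = u ! j" "move i 2 u w"
    by auto
  have other: "j \<notin> block D \<and> j \<notin> {1..<9}" if "j \<in> block d" "d < D" for j d
    using that by (auto simp: block_def)
  have "\<forall>d<Suc D. \<forall>j\<in>block d. w ! j = c"
  proof (intro allI impI ballI)
    fix d j assume d: "d < Suc D" and j: "j \<in> block d"
    show "w ! j = c"
    proof (cases "d = D")
      case False
      with d have "d < D" by simp
      with w(3) u(2) other[OF j] j show ?thesis by simp
    qed (use w(2) j in simp)
  qed
  moreover have "\<forall>j. j \<notin> {1..<9} \<and> (\<forall>d<Suc D. j \<notin> block d) \<longrightarrow> w ! j = v ! j"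
    using w(3) u(3) by auto
  moreover have "move i (2 * Suc D) v w" using move_trans[OF u(4) w(4)] by simp
  ultimately show ?case using w(1) by blast
qed

lemma block_cover: "9 + M \<le> j \<Longrightarrow> j < n \<Longrightarrow> \<exists>d<4. j \<in> block d"
  by (auto simp: block_def)

text \<open>The current type is 0, so \<open>sp\<close> or \<open>sq\<close> is 0. The coordinates
  of the other one are cleared first; this makes it 0 as well, so that it keeps the vertex in the
  layer while the remaining type coordinates are cleared.\<close>

lemma route_from_layer:
  assumes i: "i < M" and v: "layer i v" "ss v = 0" "v ! 0 = c"
    "\<And>j. j \<in> {9..<9 + M} \<Longrightarrow> v ! j = root i ! j" "\<And>j. 9 + M \<le> j \<Longrightarrow> j < n \<Longrightarrow> v ! j = c"
  shows "move i 0 v (root i)"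
proof -
  let ?P = "\<lambda>u. u \<in> W \<and> sw u = 0 \<and> sk u = i \<and> ss u = 0 \<and> sp u = 0"
  let ?Q = "\<lambda>u. u \<in> W \<and> sw u = 0 \<and> sk u = i \<and> ss u = 0 \<and> sq u = 0"
  have clear_q: "\<exists>u. ?P u \<and> (\<forall>j\<in>{5..<9}. u ! j = c) \<and>
      (\<forall>j. j \<notin> {5..<9} \<longrightarrow> u ! j = w ! j) \<and> move i 0 w u" if "?P w" for w
    using that dimension flip_W by (intro clear) (auto simp: C_def col_def state_flip)
  have clear_p: "\<exists>u. ?Q u \<and> (\<forall>j\<in>{1..<5}. u ! j = c) \<and>
      (\<forall>j. j \<notin> {1..<5} \<longrightarrow> u ! j = w ! j) \<and> move i 0 w u" if "?Q w" for w
    using that dimension flip_W by (intro clear) (auto simp: C_def col_def state_flip)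
  have p0: "sp u = 0" if "\<forall>j\<in>{1..<5}. u ! j = c" for u
    unfolding sp_def using that by (intro syn_zero) (auto split: if_splits)
  have q0: "sq u = 0" if "\<forall>j\<in>{5..<9}. u ! j = c" for u
    unfolding sq_def using that by (intro syn_zero) (auto split: if_splits)
  have "\<exists>u. u \<in> W \<and> (\<forall>j\<in>{1..<9}. u ! j = c) \<and> (\<forall>j. j \<notin> {1..<9} \<longrightarrow> u ! j = v ! j) \<and> move i 0 v u"
  proof (cases "sp v = 0")
    case True
    with v have "?P v" by (simp add: layer_def)
    from clear_q[OF this] obtain u where u: "?P u" "\<forall>j\<in>{5..<9}. u ! j = c"
      "\<forall>j. j \<notin> {5..<9} \<longrightarrow> u ! j = v ! j" "move i 0 v u" by blast
    then have "?Q u" using q0 by simp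
    from clear_p[OF this] obtain w where w: "?Q w" "\<forall>j\<in>{1..<5}. w ! j = c"
      "\<forall>j. j \<notin> {1..<5} \<longrightarrow> w ! j = u ! j" "move i 0 u w" by blast
    have "w ! j = (if j \<in> {1..<9} then c else v ! j)" for j
      using w(2,3) u(2,3) by (cases "j \<in> {1..<5}"; cases "j \<in> {5..<9}") auto
    with move_trans[OF u(4) w(4)] w(1) show ?thesis by (intro exI[of _ w]) simp
  next
    case False
    with v have "?Q v" by (simp add: layer_def)
    from clear_p[OF this] obtain u where u: "?Q u" "\<forall>j\<in>{1..<5}. u ! j = c"
      "\<forall>j. j \<notin> {1..<5} \<longrightarrow> u ! j = v ! j" "move i 0 v u" by blast
    then have "?P u" using p0 by simp
    from clear_q[OF this] obtain w where w: "?P w" "\<forall>j\<in>{5..<9}. w ! j = c"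
      "\<forall>j. j \<notin> {5..<9} \<longrightarrow> w ! j = u ! j" "move i 0 u w" by blast
    have "w ! j = (if j \<in> {1..<9} then c else v ! j)" for j
      using w(2,3) u(2,3) by (cases "j \<in> {1..<5}"; cases "j \<in> {5..<9}") auto
    with move_trans[OF u(4) w(4)] w(1) show ?thesis by (intro exI[of _ w]) simp
  qed
  then obtain u where u: "u \<in> W" "\<forall>j\<in>{1..<9}. u ! j = c" "\<forall>j. j \<notin> {1..<9} \<longrightarrow> u ! j = v ! j"
    "move i 0 v u" by blast
  have "u ! j = root i ! j" if "j < n" for j
  proof -
    consider "j = 0" | "j \<in> {1..<9}" | "j \<in> {9..<9 + M}" | "9 + M \<le> j" by force
    then show ?thesis
      using u(2,3) v(3-5) that i by cases (auto simp: root_def)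
  qed
  then have "u = root i"
    using u(1) by (intro nth_equalityI) (auto simp: length_W root_def)
  with u show ?thesis by simp
qed

text \<open>The allowance 16 consists of 2 for the residue, 2 for the flag, 4 for entering the
  layer, 8 for the four blocks and 0 for the final descent.\<close>

lemma route:
  assumes i: "i < M" and v: "v \<in> C i"
  shows "move i 16 v (root i)"
proof -
  from route_to_residue[OF i v] obtain u1 where u1: "u1 \<in> C i" "ss u1 div 4 = i" "move i 2 v u1"
    by blast
  from route_to_flag[OF u1(1,2)] obtain u2 where u2: "u2 \<in> W" "sw u2 = 1" "ss u2 div 4 = i"
    "move i 2 u1 u2" by blast
  from route_to_layer[OF i u2(1-3)] obtain u3 where u3: "layer i u3" "u3 ! 0 = c"
    "\<forall>j\<in>{9..<9 + M}. u3 ! j = root i ! j" "move i 4 u2 u3" by blast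
  from route_in_layer[OF u3(1), of 4] obtain u4 where u4: "layer i u4"
    "\<forall>d<4. \<forall>j\<in>block d. u4 ! j = c"
    "\<forall>j. j \<notin> {1..<9} \<and> (\<forall>d<4. j \<notin> block d) \<longrightarrow> u4 ! j = u3 ! j" "move i 8 u3 u4"
    by auto
  have x: "u4 ! j = c" if "9 + M \<le> j" "j < n" for j
    using block_cover[OF that] u4(2) by blast
  have "ss u4 = 0"
    unfolding ss_def using x by (intro syn_zero) (auto split: if_splits)
  moreover have "u4 ! j = u3 ! j" if "j = 0 \<or> j \<in> {9..<9 + M}" for j
    using that by (intro u4(3)[rule_format]) (auto simp: block_def)
  ultimately have "move i 0 u4 (root i)"
    using u4(1) u3(2,3) x by (intro route_from_layer[OF i]) auto
  from move_trans[OF move_trans[OF move_trans[OF move_trans[OF u1(3) u2(4)] u3(4)] u4(4)] this]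
  show ?thesis by simp
qed

lemma root_C:
  assumes "i < M"
  shows "root i \<in> C i"
proof -
  let ?v = "replicate n c"
  have v: "?v \<in> W" using root_vertex by (auto simp: W_def)
  have flip: "flip (9 + i) ?v = root i"
    using assms dimension by (simp add: flip_def root_def)
  have zero: "syn lab ?v = 0" for lab by (rule syn_zero) simp
  have "root i \<in> W" using flip_W[OF v, of "9 + i"] unfolding flip .
  moreover note set_k[OF v assms, unfolded flip]
  ultimately show ?thesis
    by (simp add: C_def col_def zero sk_def ss_def sw_def sp_def)
qed

text \<open>The initial potential, at most \<open>n * r\<close>, pays for all steps beyond the
  allowance.\<close>

lemma reach_root:
  assumes "i < M" "v \<in> C i"
  shows "\<exists>l \<le> n * r + 16. (step i ^^ l) v (root i)"
proof -
  from route[OF assms] obtain l where "(step i ^^ l) v (root i)" "l \<le> depth_sum v + 16"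
    unfolding move_def by fastforce
  moreover have "depth_sum v \<le> n * r" using assms depth_sum_le by (simp add: C_def)
  ultimately show ?thesis by (intro exI[of _ l]) auto
qed

section \<open>Attaching the leaves\<close>

text \<open>The choice depends on \<open>p\<close> and \<open>q\<close> alone, so the two ends of an
  attaching edge, which share \<open>sp\<close> and \<open>sq\<close>, agree on it.\<close>

definition free_types :: "nat \<Rightarrow> nat \<Rightarrow> nat \<times> nat" where
  "free_types p q = (SOME (a, b). a < 4 \<and> b < 4 \<and> a \<noteq> b \<and> a \<notin> {p, q} \<and> b \<notin> {p, q})"

lemma free_types:
  obtains a b where "free_types p q = (a, b)" "a < 4" "b < 4" "a \<noteq> b" "a \<notin> {p, q}" "b \<notin> {p, q}"
proof -
  have "2 \<le> card ({..<4} - {p, q})"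
    using diff_card_le_card_Diff[of "{p, q}" "{..<4::nat}"] card_insert_le_m1[of 2 "{q}" p]
    by (simp add: card_insert_if split: if_splits)
  then obtain S where "S \<subseteq> {..<4} - {p, q}" "card S = 2"
    by (rule obtain_subset_with_card_n)
  then obtain a b where "a \<in> {..<4} - {p, q}" "b \<in> {..<4} - {p, q}" "a \<noteq> b"
    by (auto simp: card_2_iff)
  then have "\<exists>x. case x of (a, b) \<Rightarrow> a < 4 \<and> b < 4 \<and> a \<noteq> b \<and> a \<notin> {p, q} \<and> b \<notin> {p, q}"
    by auto
  from someI_ex[OF this] show ?thesis
    using that unfolding free_types_def[symmetric] by (auto split: prod.splits)
qed

text \<open>With \<open>rep1\<close> this gives two syndromes of quotient \<open>i\<close> whose
  types are never recoloured at these \<open>sp\<close> and \<open>sq\<close>, so they yield colour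
  \<open>i\<close> whatever the flag is.\<close>

definition rep0 :: "'a list \<Rightarrow> nat \<Rightarrow> nat" where
  "rep0 v i = 4 * i + fst (free_types (sp v) (sq v))"

definition rep1 :: "'a list \<Rightarrow> nat \<Rightarrow> nat" where
  "rep1 v i = 4 * i + snd (free_types (sp v) (sq v))"

text \<open>
  Between the classes \<open>i < j\<close> the representatives are joined along the directed 4-cycle
  \<open>rep0 i \<rightarrow> rep0 j \<rightarrow> rep1 i \<rightarrow> rep1 j \<rightarrow> rep0 i\<close>, so that no edge is used by both trees.
\<close>

definition target :: "'a list \<Rightarrow> nat \<Rightarrow> nat" where
  "target v i =
    (if col v < i then (if ss v = rep1 v (col v) then rep1 v i else rep0 v i)
     else (if ss v = rep0 v (col v) then rep1 v i else rep0 v i))"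

definition attach :: "nat \<Rightarrow> 'a list \<Rightarrow> 'a list" where
  "attach i v = flip (9 + M + (ss v XOR target v i)) v"

lemma rep_neq: "rep0 v i \<noteq> rep1 v i"
  using free_types[of "sp v" "sq v"] unfolding rep0_def rep1_def by (metis add_left_cancel fst_conv snd_conv)

lemma rep_type: "t \<in> {rep0 v i, rep1 v i} \<Longrightarrow> t div 4 = i \<and> t mod 4 \<notin> {sp v, sq v}"
  by (rule free_types[of "sp v" "sq v"]) (auto simp: rep0_def rep1_def)

lemma target_rep: "target v i \<in> {rep0 v i, rep1 v i}"
  by (simp add: target_def)

lemma target_less:
  assumes "i < M"
  shows "target v i < 4 * M"
proof -
  have "target v i div 4 < M" using rep_type[OF target_rep] assms by metis
  then show ?thesis by (simp add: div_less_iff_less_mult mult.commute)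
qed

lemma attach:
  assumes "i < M" "v \<in> W"
  shows "attach i v \<in> C i" "sp (attach i v) = sp v" "sq (attach i v) = sq v"
    "ss (attach i v) = target v i"
proof -
  note state = set_s[OF assms(2) target_less[OF assms(1), of v], folded attach_def]
  show "sp (attach i v) = sp v" "sq (attach i v) = sq v" "ss (attach i v) = target v i"
    using state by simp_all
  have "attach i v \<in> W" unfolding attach_def using flip_W[OF assms(2)] .
  then show "attach i v \<in> C i"
    using state rep_type[OF target_rep, of v i] by (auto simp: C_def col_def)
qed

text \<open>Attaching changes neither \<open>sp\<close> nor \<open>sq\<close>, so \<open>u\<close>
  and \<open>v\<close> have the same representatives. Two steps along the directed 4-cycle lead to
  the other representative of the same class, so attaching \<open>v\<close> to \<open>u\<close> and
  then \<open>u\<close> to \<open>v\<close> is impossible.\<close>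

lemma attach_no_swap_less:
  assumes "i < M" "j < M" "i < j" "u \<in> C i" "v \<in> C j" "attach i v = u" "attach j u = v"
  shows False
proof -
  have W: "u \<in> W" "v \<in> W" and col: "col u = i" "col v = j" using assms by (auto simp: C_def)
  note u = attach(2-4)[OF \<open>i < M\<close> W(2), unfolded assms(6)]
  note v = attach(2-4)[OF \<open>j < M\<close> W(1), unfolded assms(7)]
  have rep: "rep0 u k = rep0 v k" "rep1 u k = rep1 v k" for k using u by (simp_all add: rep0_def rep1_def)
  show False
    using u(3) v(3) rep_neq[of v i] rep_neq[of v j] \<open>i < j\<close>
    by (auto simp: target_def col rep split: if_splits)
qed

lemma attach_no_swap:
  assumes "i < M" "j < M" "i \<noteq> j" "u \<in> C i" "v \<in> C j" "attach i v = u" "attach j u = v"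
  shows False
  using attach_no_swap_less[of i j u v] attach_no_swap_less[of j i v u] assms
  by (cases i j rule: linorder_cases) auto

section \<open>Assembling the trees\<close>

lemma finite_W: "finite W"
  unfolding W_def using finite_lists_length_eq[OF H.pair_finite_verts, of n] by (simp add: conj_commute)

lemma flip_arc:
  assumes "v \<in> W" "j < n"
  shows "(v, flip j v) \<in> parcs (cartesian_power H n)"
  using assms nb_arc[OF W_nth[OF assms]] flip_W[OF assms(1), of j] flip_nth flip_nth_other
  by (auto simp: cartesian_power_def Let_def W_def)

text \<open>The class \<open>C i\<close> is joined to its root along steps; an attached leaf lies
  one edge further out, which turns 16 into 17.\<close>

lemma tree_exists:
  assumes i: "i < M"
  shows "\<exists>\<pi> d. ranked_parent W (root i) \<pi> d \<and> (\<forall>v\<in>W. d v \<le> n * r + 17) \<and>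
    (\<forall>v\<in>W - {root i}. \<pi> v \<in> C i \<and> (v, \<pi> v) \<in> parcs (cartesian_power H n)) \<and>
    (\<forall>v\<in>W - C i. \<pi> v = attach i v)"
proof -
  have CW: "C i \<subseteq> W" by (auto simp: C_def)
  have "\<exists>\<pi> d. ranked_parent W (root i) \<pi> d \<and> (\<forall>v\<in>W. d v \<le> Suc (n * r + 16)) \<and>
    (\<forall>v\<in>C i - {root i}. step i v (\<pi> v)) \<and> (\<forall>v\<in>W - C i. \<pi> v = attach i v)"
  proof (rule ranked_parent_exists)
    show "w \<in> C i" if "step i v w" for v w using that by (simp add: step_def)
    show "attach i v \<in> C i" if "v \<in> W - C i" for v using attach(1)[OF i] that by blast
  qed (use finite_W CW root_C[OF i] reach_root[OF i] in auto)
  then obtain \<pi> d where \<pi>: "ranked_parent W (root i) \<pi> d" "\<forall>v\<in>W. d v \<le> Suc (n * r + 16)"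
    "\<forall>v\<in>C i - {root i}. step i v (\<pi> v)" "\<forall>v\<in>W - C i. \<pi> v = attach i v" by blast
  have "\<pi> v \<in> C i \<and> (v, \<pi> v) \<in> parcs (cartesian_power H n)" if v: "v \<in> W - {root i}" for v
  proof (cases "v \<in> C i")
    case True
    with \<pi>(3) v have "step i v (\<pi> v)" by blast
    then obtain j where "j < n" "\<pi> v = flip j v" "\<pi> v \<in> C i" unfolding step_def by blast
    with flip_arc[of v j] v show ?thesis by simp
  next
    case False
    with \<pi>(4) v have eq: "\<pi> v = attach i v" by simp
    have "9 + M + (ss v XOR target v i) < n"
      using xor_less_4M[OF ss_less[of v] target_less[OF i, of v]] dimension by simp
    with flip_arc[of v] v have "(v, attach i v) \<in> parcs (cartesian_power H n)"
      by (simp add: attach_def)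
    with attach(1)[OF i, of v] v show ?thesis by (simp add: eq)
  qed
  moreover have "\<forall>v\<in>W. d v \<le> n * r + 17" using \<pi>(2) by fastforce
  ultimately show ?thesis using \<pi>(1,4) by (intro exI[of _ \<pi>] exI[of _ d]) blast
qed

lemma independent_trees_exist:
  assumes "k \<le> M"
  shows "\<exists>\<T>. finite \<T> \<and> card \<T> = k \<and>
    (\<forall>T\<in>\<T>. undirected_spanning_tree T (cartesian_power H n) \<and>
      graph_diameter (with_proj T) \<le> 2 * (n * r + 17)) \<and>
    pairwise completely_independent \<T>"
proof -
  let ?G = "cartesian_power H n"
  interpret G: pair_graph ?G by (rule pair_graph_cartesian_power) unfold_locales
  have WG: "pverts ?G = W" by (simp add: cartesian_power_def Let_def W_def)
  define Q where "Q i \<pi> d \<longleftrightarrow> ranked_parent W (root i) \<pi> d \<and> (\<forall>v\<in>W. d v \<le> n * r + 17) \<and>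
    (\<forall>v\<in>W - {root i}. \<pi> v \<in> C i \<and> (v, \<pi> v) \<in> parcs ?G) \<and>
    (\<forall>v\<in>W - C i. \<pi> v = attach i v)" for i \<pi> d
  have "\<forall>i\<in>{..<M}. \<exists>\<pi> d. Q i \<pi> d" using tree_exists unfolding Q_def by blast
  then obtain \<pi> d where Q: "\<And>i. i < M \<Longrightarrow> Q i (\<pi> i) (d i)" by (metis lessThan_iff)
  define T where "T i = parent_tree W (root i) (\<pi> i)" for i
  have tree: "undirected_spanning_tree (T i) ?G \<and> graph_diameter (with_proj (T i)) \<le> 2 * (n * r + 17) \<and>
      parcs (T i) \<noteq> {}" if i: "i < M" for i
  proof -
    interpret R: ranked_parent W "root i" "\<pi> i" "d i" using Q[OF i] by (simp add: Q_def)
    have "parcs R.T \<subseteq> parcs ?G"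
      using Q[OF i] G.arcs_symmetric by (auto simp: Q_def R.parcs_T)
    then have "subgraph (with_proj R.T) (with_proj ?G)"
      by (auto simp: subgraph_def compatible_def R.pverts_T WG intro: R.T.wf_digraph_axioms G.wf_digraph_axioms)
    then have "undirected_spanning_tree R.T ?G"
      by (simp add: undirected_spanning_tree_def R.undirected_tree_T spanning_def R.pverts_T WG)
    moreover have "graph_diameter (with_proj R.T) \<le> 2 * (n * r + 17)"
      using Q[OF i] by (intro R.graph_diameter_T) (auto simp: Q_def)
    \<comment> \<open>An explicit arc of the tree is needed below to tell the trees apart.\<close>
    moreover have "(flip 0 (root i), \<pi> i (flip 0 (root i))) \<in> parcs R.T"
    proof (rule R.parcs_T_parent)
      show "flip 0 (root i) \<in> W" using flip_W R.root_in .
      have "(root i, flip 0 (root i)) \<in> parcs ?G"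
        using flip_arc[OF R.root_in, of 0] dimension by simp
      then show "flip 0 (root i) \<noteq> root i" using G.no_loops' by metis
    qed
    ultimately show ?thesis unfolding T_def by blast
  qed
  have indep: "completely_independent (T i) (T j)" if "i < M" "j < M" "i \<noteq> j" for i j
    unfolding T_def
  proof (rule ranked_parent_disjoint_parents_completely_independent)
    show "ranked_parent W (root i) (\<pi> i) (d i)" "ranked_parent W (root j) (\<pi> j) (d j)"
      using Q that by (simp_all add: Q_def)
    show "\<pi> i v \<in> C i" if "v \<in> W - {root i}" for v using Q[OF \<open>i < M\<close>] that by (simp add: Q_def)
    show "\<pi> j v \<in> C j" if "v \<in> W - {root j}" for v using Q[OF \<open>j < M\<close>] that by (simp add: Q_def)
    show "C i \<inter> C j = {}" using \<open>i \<noteq> j\<close> by (auto simp: C_def)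
    show False if uv: "u \<in> C i" "v \<in> C j" "v \<in> W" "u \<in> W" "\<pi> i v = u" "\<pi> j u = v" for u v
    proof -
      \<comment> \<open>Each end lies outside the class of the other, so both parents come from
        \<open>attach\<close>.\<close>
      have "v \<notin> C i" "u \<notin> C j" using uv \<open>i \<noteq> j\<close> by (auto simp: C_def)
      then have "attach i v = u" "attach j u = v"
        using Q[OF \<open>i < M\<close>] Q[OF \<open>j < M\<close>] uv by (auto simp: Q_def)
      with attach_no_swap[OF \<open>i < M\<close> \<open>j < M\<close> \<open>i \<noteq> j\<close> uv(1,2)] show False by blast
    qed
  qed
  \<comment> \<open>A tree with an arc is not completely independent of itself, so different colours
    give different trees.\<close>
  have "inj_on T {..<k}"
  proof (rule inj_onI, rule ccontr)
    fix i j assume ij: "i \<in> {..<k}" "j \<in> {..<k}" "T i = T j" "i \<noteq> j"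
    then have "completely_independent (T i) (T j)" using assms by (intro indep) auto
    then have "parcs (T i) = {}" using ij(3) by (simp add: completely_independent_def)
    with tree[of i] ij(1) assms show False by simp
  qed
  then have "card (T ` {..<k}) = k" by (simp add: card_image)
  moreover have "pairwise completely_independent (T ` {..<k})"
    using assms by (auto simp: pairwise_def intro!: indep)
  ultimately show ?thesis
    using tree assms by (intro exI[of _ "T ` {..<k}"]) auto
qed

end

section \<open>The main theorem\<close>

text \<open>The centre \<open>c\<close> attains the radius and \<open>dep\<close> is the distance
  from it. A second vertex provides \<open>c\<close> with a neighbour, which has depth 1 and makes
  the radius positive.\<close>

lemma neighbour_depth_exists:
  assumes H: "pair_graph H" and conn: "Digraph_Component.connected (with_proj H)"
    and two: "2 \<le> card (pverts H)"
  shows "\<exists>c nb dep. 0 < graph_radius (with_proj H) \<and>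
    (\<forall>m n. 9 + 5 * 2 ^ m \<le> n \<longrightarrow> neighbour_depth H c nb dep (graph_radius (with_proj H)) m n)"
proof -
  interpret H: pair_graph H by (fact H)
  let ?D = "graph_dist (with_proj H)"
  let ?ecc = "\<lambda>u. MAX v\<in>pverts H. ?D u v"
  define r where "r = graph_radius (with_proj H)"
  have ne: "pverts H \<noteq> {}" using two by auto
  have "r = Min (?ecc ` pverts H)" by (simp add: r_def graph_radius_def)
  also have "\<dots> \<in> ?ecc ` pverts H" using ne H.pair_finite_verts by (intro Min_in) auto
  finally obtain c where c: "c \<in> pverts H" "r = ?ecc c" by blast
  define dep where "dep = ?D c"
  have dep_r: "dep v \<le> r" if "v \<in> pverts H" for v
    unfolding c(2) dep_def using that H.pair_finite_verts by (intro Max_ge) auto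
  have dep_le: "dep v \<le> length p" if "H.awalk c p v" for p v
    unfolding dep_def graph_dist_def using that by (intro Least_le) blast
  have walk: "\<exists>p. H.awalk c p v \<and> length p = dep v" if v: "v \<in> pverts H" for v
  proof -
    have "c \<rightarrow>\<^sup>*\<^bsub>with_proj H\<^esub> v"
      using conn c(1) v by (auto simp: Digraph_Component.connected_def H.mk_symmetric_eq)
    then have "\<exists>k p. H.awalk c p v \<and> length p = k" by (auto simp: H.reachable_awalk)
    from LeastI_ex[OF this] show ?thesis unfolding dep_def graph_dist_def .
  qed
  have dep_c: "dep c = 0" using dep_le[of "[]" c] c(1) by (simp add: H.awalk_Nil_iff)
  have dep_0: "v = c" if "v \<in> pverts H" "dep v = 0" for v
    using walk[OF that(1)] that(2) by (auto simp: H.awalk_Nil_iff)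
  have dep_arc: "dep v \<le> Suc (dep u)" if uv: "(u, v) \<in> parcs H" for u v
  proof -
    have "u \<in> pverts H" using uv by (rule H.in_arcsD1)
    from walk[OF this] obtain p where p: "H.awalk c p u" "length p = dep u" by blast
    then have "H.awalk c (p @ [(u, v)]) v"
      using uv H.in_arcsD2[OF uv] by (intro H.awalk_appendI) (auto simp: H.awalk_simps H.in_arcsD1)
    from dep_le[OF this] p(2) show ?thesis by simp
  qed
  have parent: "\<exists>u. (v, u) \<in> parcs H \<and> dep v = Suc (dep u)" if v: "v \<in> pverts H" "v \<noteq> c" for v
  proof -
    from walk[OF v(1)] obtain p where p: "H.awalk c p v" "length p = dep v" by blast
    with v(2) have "p \<noteq> []" by (auto simp: H.awalk_Nil_iff)
    then obtain q e where q: "p = q @ [e]" by (metis rev_exhaust)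
    obtain u w where e: "e = (u, w)" by (cases e)
    have "H.awalk c q u" "(u, v) \<in> parcs H"
      using p(1) unfolding q e by (auto simp: H.awalk_append_iff H.awalk_simps)
    \<comment> \<open>The shortest walk without its last arc gives \<open>dep u < dep v\<close>, and
      the arc itself gives \<open>dep v \<le> Suc (dep u)\<close>.\<close>
    with dep_le[of q u] dep_arc[of u v] p(2) show ?thesis
      unfolding q by (intro exI[of _ u]) (auto intro: H.arcs_symmetric)
  qed
  have child: "\<exists>u. (c, u) \<in> parcs H \<and> dep u = 1"
  proof -
    have "pverts H \<noteq> {c}" using two by auto
    then obtain v where v: "v \<in> pverts H" "v \<noteq> c" using c(1) by blast
    from walk[OF v(1)] obtain p where p: "H.awalk c p v" by blast
    with v(2) obtain e q where "p = e # q" by (cases p) (auto simp: H.awalk_Nil_iff)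
    with p obtain u where u: "(c, u) \<in> parcs H" by (cases e) (auto simp: H.awalk_Cons_iff)
    then have "dep u \<noteq> 0" using dep_0 H.in_arcsD2 H.no_loops' by metis
    with dep_arc[OF u] dep_c u show ?thesis by (intro exI[of _ u]) simp
  qed
  define nb where "nb v = (SOME u. (v, u) \<in> parcs H \<and> (if v = c then dep u = 1 else dep v = Suc (dep u)))" for v
  have nb: "(v, nb v) \<in> parcs H \<and> (if v = c then dep (nb v) = 1 else dep v = Suc (dep (nb v)))"
    if "v \<in> pverts H" for v
    unfolding nb_def by (rule someI_ex) (use parent[OF that] child in auto)
  have "0 < r" using dep_r[of "nb c"] nb[OF c(1)] H.in_arcsD2 by fastforce
  moreover have "neighbour_depth H c nb dep r m n" if "9 + 5 * 2 ^ m \<le> n" for m n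
    by unfold_locales (use c(1) dep_c nb dep_r that in \<open>auto split: if_splits\<close>)
  ultimately show ?thesis unfolding r_def by blast
qed

text \<open>The least power of two that is at least \<open>n / 12\<close> is below
  \<open>n / 6\<close>, as half of it is below \<open>n / 12\<close>. Five times it is then below
  \<open>5 * n / 6\<close>, which leaves \<open>n / 6\<close>, at least 9 as \<open>n\<close> is at
  least 54.\<close>

lemma power_of_two_between:
  assumes "54 \<le> (n :: nat)"
  shows "\<exists>m. n div 12 \<le> 2 ^ m \<and> 9 + 5 * 2 ^ m \<le> n"
proof -
  have "n < 2 ^ n" by (rule less_exp)
  then have ex: "\<exists>m. n \<le> 12 * 2 ^ m" by (intro exI[of _ n]) linarith
  define m where "m = (LEAST m. n \<le> 12 * 2 ^ m)"
  have m: "n \<le> 12 * 2 ^ m" unfolding m_def using ex by (rule LeastI_ex)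
  have "6 * 2 ^ m < n"
  proof (cases m)
    case 0
    with assms show ?thesis by simp
  next
    case (Suc k)
    then have "\<not> n \<le> 12 * 2 ^ k" unfolding m_def using not_less_Least by (metis lessI)
    with Suc show ?thesis by simp
  qed
  with m assms show ?thesis by (intro exI[of _ m]) auto
qed

theorem theorem3:
  fixes H :: "'a pair_pre_digraph"
  assumes "pair_graph H"
    and "Digraph_Component.connected (with_proj H)"
    and "card (pverts H) \<ge> 2"
  shows "\<exists>f g :: nat \<Rightarrow> nat.
    (\<lambda>n. real (f n) / real n) \<longlonglongrightarrow> 1 / 12 \<and>
    (\<lambda>n. real (g n) / (real n * real (graph_radius (with_proj H)))) \<longlonglongrightarrow> 2 \<and>
    (\<forall>\<^sub>F n in sequentially. \<exists>\<T>.
       finite \<T> \<and> card \<T> = f n \<and>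
       (\<forall>T\<in>\<T>. undirected_spanning_tree T (cartesian_power H n) \<and>
              graph_diameter (with_proj T) \<le> g n) \<and>
       pairwise completely_independent \<T>)"
proof -
  let ?r = "graph_radius (with_proj H)"
  from neighbour_depth_exists[OF assms] obtain c nb dep where r: "0 < ?r"
    and nd: "\<And>m n. 9 + 5 * 2 ^ m \<le> n \<Longrightarrow> neighbour_depth H c nb dep ?r m n" by blast
  define f where "f n = n div 12" for n :: nat
  define g where "g n = 2 * (n * ?r + 17)" for n
  have "(\<lambda>n. real (f n) / real n) \<longlonglongrightarrow> 1 / 12"
  proof (rule tendsto_sandwich)
    have bounds: "real n / 12 - 1 \<le> real (f n) \<and> real (f n) \<le> real n / 12" for n
      unfolding f_def by linarith
    show "\<forall>\<^sub>F n in sequentially. 1 / 12 - 1 / real n \<le> real (f n) / real n"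
      using eventually_gt_at_top[of 0]
    proof eventually_elim
      case (elim n)
      then have "1 / 12 - 1 / real n = (real n / 12 - 1) / real n" by (simp add: field_simps)
      also have "\<dots> \<le> real (f n) / real n" using bounds[of n] by (intro divide_right_mono) auto
      finally show ?case .
    qed
    show "\<forall>\<^sub>F n in sequentially. real (f n) / real n \<le> 1 / 12"
      using eventually_gt_at_top[of 0]
    proof eventually_elim
      case (elim n)
      then show ?case using bounds[of n] by (simp add: field_simps)
    qed
    show "(\<lambda>n. 1 / 12 - 1 / real n) \<longlonglongrightarrow> 1 / 12"
      using tendsto_diff[OF tendsto_const lim_1_over_n] by simp
  qed simp
  moreover have "(\<lambda>n. real (g n) / (real n * real ?r)) \<longlonglongrightarrow> 2"
  proof (rule Lim_transform_eventually)
    \<comment> \<open>The constant 34 is twice the 17 in \<open>g\<close>; the radius is fixed and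
      positive, so this term vanishes in the limit.\<close>
    show "(\<lambda>n. 2 + 34 / real ?r * (1 / real n)) \<longlonglongrightarrow> 2"
      using tendsto_add[OF tendsto_const[of "2 :: real"]
          tendsto_mult_right_zero[OF lim_1_over_n, of "34 / real ?r"]] by simp
    show "\<forall>\<^sub>F n in sequentially. 2 + 34 / real ?r * (1 / real n) = real (g n) / (real n * real ?r)"
      using eventually_gt_at_top[of 0]
    proof eventually_elim
      case (elim n)
      with r show ?case by (simp add: g_def field_simps)
    qed
  qed
  moreover have "\<forall>\<^sub>F n in sequentially. \<exists>\<T>. finite \<T> \<and> card \<T> = f n \<and>
       (\<forall>T\<in>\<T>. undirected_spanning_tree T (cartesian_power H n) \<and>
              graph_diameter (with_proj T) \<le> g n) \<and>
       pairwise completely_independent \<T>"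
    using eventually_ge_at_top[of 54]
  proof eventually_elim
    case (elim n)
    then obtain m where "n div 12 \<le> 2 ^ m" "9 + 5 * 2 ^ m \<le> n" using power_of_two_between by blast
    then show ?case
      using neighbour_depth.independent_trees_exist[OF nd] unfolding f_def g_def by blast
  qed
  ultimately show ?thesis by blast
qed

end
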